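(* Let $Q$ be a real symmetric positive definite $n\times n$ matrix. For all real $n\times n$ matrices $X,Y$, $$\|e^Xe^Y-e^{X+Y}\|_Q\le e^{\|X\|_Q+\|Y\|_Q}\,g(\|X\|_Q)\,\|[X,Y]\|_Q .$$
   Context: For a real symmetric positive definite $n\times n$ matrix $Q$, set $\|x\|_Q=\sqrt{x^\top Qx}$ for $x\in\mathbb R^n$, and let $\|M\|_Q=\sup_{x\ne0}\|Mx\|_Q/\|x\|_Q$ be the induced operator norm of a real $n\times n$ matrix $M$. $[X,Y]=XY-YX$ is the matrix commutator. The scalar function $g$ is $$g(z)=\int_0^1(1-s)e^{2zs}\,ds,$$ that is, $g(z)=\frac{e^{2z}-1-2z}{4z^2}$ for $z\neq0$ and $g(0)=\frac12$. *)

theory Defs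
  imports "HOL-Analysis.Analysis"
begin

definition pos_def_matrix :: "real^'n^'n \<Rightarrow> bool" where
  "pos_def_matrix Q \<longleftrightarrow> (\<forall>x. x \<noteq> 0 \<longrightarrow> 0 < x \<bullet> (Q *v x))"

definition vec_norm_Q :: "real^'n^'n \<Rightarrow> real^'n \<Rightarrow> real" where
  "vec_norm_Q Q x = sqrt (x \<bullet> (Q *v x))"

definition op_norm_Q :: "real^'n^'n \<Rightarrow> real^'n^'n \<Rightarrow> real" where
  "op_norm_Q Q M = (SUP x\<in>{x. x \<noteq> 0}. vec_norm_Q Q (M *v x) / vec_norm_Q Q x)"

definition commutator :: "real^'n^'n \<Rightarrow> real^'n^'n \<Rightarrow> real^'n^'n" where
  "commutator X Y = X ** Y - Y ** X"

text \<open>The library's \<open>*\<close> and \<open>^\<close> on type \<open>real^'n^'n\<close> act entrywise, so powers with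
  respect to the matrix product \<open>**\<close> are spelled out.\<close>

definition matrix_pow :: "real^'n^'n \<Rightarrow> nat \<Rightarrow> real^'n^'n" where
  "matrix_pow A k = (((**) A) ^^ k) (mat 1)"

definition matrix_exp :: "real^'n^'n \<Rightarrow> real^'n^'n" where
  "matrix_exp A = (\<Sum>k. (1 / fact k) *\<^sub>R matrix_pow A k)"

definition g :: "real \<Rightarrow> real" where
  "g z = integral {0..1} (\<lambda>s. (1 - s) * exp (2 * z * s))"

text \<open>The series, the supremum and the integral above are not instances of the junk values
  that \<open>suminf\<close>, \<open>Sup\<close> and \<open>integral\<close> take outside their domain.\<close>

lemma matrix_pow_entry_bound:
  fixes A :: "real^'n^'n"
  assumes "\<And>i j. \<bar>A $ i $ j\<bar> \<le> b"
  shows "\<bar>matrix_pow A k $ i $ j\<bar> \<le> (real CARD('n) * b) ^ k"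
proof (induction k arbitrary: i j)
  case 0
  show ?case by (simp add: matrix_pow_def mat_def)
next
  case (Suc k)
  have "matrix_pow A (Suc k) $ i $ j = (\<Sum>l\<in>UNIV. A $ i $ l * matrix_pow A k $ l $ j)"
    by (simp add: matrix_pow_def matrix_matrix_mult_def)
  also have "\<bar>\<dots>\<bar> \<le> (\<Sum>l\<in>(UNIV::'n set). b * (real CARD('n) * b) ^ k)"
    by (rule order_trans[OF sum_abs], rule sum_mono, unfold abs_mult, rule mult_mono)
       (use assms Suc in \<open>auto intro: order_trans[OF abs_ge_zero]\<close>)
  finally show ?case by simp
qed

lemma summable_matrix_exp:
  fixes A :: "real^'n^'n"
  shows "summable (\<lambda>k. (1 / fact k) *\<^sub>R matrix_pow A k)"
proof -
  define b where "b = norm A"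
  have b: "\<bar>A $ i $ j\<bar> \<le> b" for i j
    unfolding b_def
    by (metis Finite_Cartesian_Product.norm_nth_le order_trans real_norm_def)
  let ?c = "real CARD('n) * b"
  have norm_pow: "norm (matrix_pow A k) \<le> (\<Sum>i\<in>(UNIV::'n set). \<Sum>j\<in>(UNIV::'n set). ?c ^ k)" for k
  proof -
    have "norm (matrix_pow A k) \<le> (\<Sum>i\<in>UNIV. norm (matrix_pow A k $ i))"
      unfolding norm_vec_def[of "matrix_pow A k"] by (rule L2_set_le_sum) simp
    also have "\<dots> \<le> (\<Sum>i\<in>(UNIV::'n set). \<Sum>j\<in>(UNIV::'n set). ?c ^ k)"
      by (intro sum_mono order_trans[OF norm_le_l1_cart] matrix_pow_entry_bound[OF b])
    finally show ?thesis .
  qed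
  have le: "norm ((1 / fact k) *\<^sub>R matrix_pow A k)
      \<le> (real CARD('n) * real CARD('n)) * (?c ^ k / fact k)" for k
    using divide_right_mono[OF norm_pow[of k], of "fact k"] by (simp add: mult.assoc)
  have "summable (\<lambda>k. ?c ^ k / fact k)"
    using summable_exp_generic[of ?c] by (simp add: divide_inverse mult.commute)
  then show ?thesis
    by (intro summable_comparison_test'[OF _ le] summable_mult)
qed

lemma vec_norm_Q_pos: "pos_def_matrix Q \<Longrightarrow> x \<noteq> 0 \<Longrightarrow> 0 < vec_norm_Q Q x"
  by (simp add: pos_def_matrix_def vec_norm_Q_def)

lemma vec_norm_Q_scaleR: "vec_norm_Q Q (c *\<^sub>R x) = \<bar>c\<bar> * vec_norm_Q Q x"
proof -
  have "(c *\<^sub>R x) \<bullet> (Q *v (c *\<^sub>R x)) = c\<^sup>2 * (x \<bullet> (Q *v x))"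
    by (simp add: matrix_vector_mult_scaleR power2_eq_square)
  then show ?thesis by (simp add: vec_norm_Q_def real_sqrt_mult)
qed

lemma bdd_above_op_norm_Q:
  fixes Q M :: "real^'n^'n"
  assumes "pos_def_matrix Q"
  shows "bdd_above ((\<lambda>x. vec_norm_Q Q (M *v x) / vec_norm_Q Q x) ` {x. x \<noteq> 0})"
proof -
  let ?f = "\<lambda>x. vec_norm_Q Q (M *v x) / vec_norm_Q Q x"
  have nz: "vec_norm_Q Q x \<noteq> 0" if "norm x = 1" for x
    using vec_norm_Q_pos[OF assms, of x] that by fastforce
  have lin: "continuous_on UNIV ((*v) A)" for A :: "real^'n^'n"
    by (rule linear_continuous_on) simp
  have "continuous_on UNIV (vec_norm_Q Q)"
    unfolding vec_norm_Q_def[abs_def] by (intro continuous_intros lin)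
  then have "continuous_on (sphere 0 1) (\<lambda>x. vec_norm_Q Q (M *v x))"
      and "continuous_on (sphere 0 1) (vec_norm_Q Q)"
    by (auto intro: continuous_on_compose2[OF _ continuous_on_subset[OF lin]] continuous_on_subset)
  then have "continuous_on (sphere 0 1) ?f"
    by (rule continuous_on_divide) (simp add: nz)
  then have "bounded (?f ` sphere 0 1)"
    by (intro compact_imp_bounded compact_continuous_image compact_sphere)
  then have bdd: "bdd_above (?f ` sphere 0 1)"
    by (rule bounded_imp_bdd_above)
  have "?f ` {x. x \<noteq> 0} \<subseteq> ?f ` sphere 0 1"
  proof (intro image_subsetI)
    fix x :: "real^'n"
    assume "x \<in> {x. x \<noteq> 0}"
    then have "?f x = ?f ((1 / norm x) *\<^sub>R x)"
      by (simp add: vec_norm_Q_scaleR matrix_vector_mult_scaleR del: scaleR_eq_0_iff)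
    moreover have "(1 / norm x) *\<^sub>R x \<in> sphere 0 1"
      using \<open>x \<in> {x. x \<noteq> 0}\<close> by simp
    ultimately show "?f x \<in> ?f ` sphere 0 1" by blast
  qed
  with bdd show ?thesis by (rule bdd_above_mono)
qed

lemma g_has_integral: "((\<lambda>s. (1 - s) * exp (2 * z * s)) has_integral g z) {0..1}"
  unfolding g_def
  by (intro integrable_integral integrable_continuous_real continuous_intros)

lemma g_zero: "g 0 = 1 / 2"
proof -
  have "((\<lambda>s. 1 - s) has_integral (1 - 1\<^sup>2 / 2) - (0 - 0\<^sup>2 / 2)) {0..1::real}"
    by (rule fundamental_theorem_of_calculus)
       (auto intro!: derivative_eq_intros simp flip: has_real_derivative_iff_has_vector_derivative)
  then show ?thesis by (simp add: g_def integral_unique)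
qed

lemma g_nonzero:
  assumes "z \<noteq> 0"
  shows "g z = (exp (2 * z) - 1 - 2 * z) / (4 * z\<^sup>2)"
proof -
  let ?F = "\<lambda>s. (1 - s) * exp (2 * z * s) / (2 * z) + exp (2 * z * s) / (4 * z\<^sup>2)"
  have "((\<lambda>s. (1 - s) * exp (2 * z * s)) has_integral ?F 1 - ?F 0) {0..1}"
  proof (rule fundamental_theorem_of_calculus)
    fix s :: real
    have "(?F has_real_derivative (1 - s) * exp (2 * z * s)) (at s within {0..1})"
      using assms by (auto intro!: derivative_eq_intros simp: field_simps power2_eq_square)
    then show "(?F has_vector_derivative (1 - s) * exp (2 * z * s)) (at s within {0..1})"
      by (simp add: has_real_derivative_iff_has_vector_derivative)
  qed simp
  then show ?thesis
    using assms by (simp add: g_def integral_unique field_simps power2_eq_square)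
qed

end

theory Submission
  imports Defs
begin

text \<open>
  Let \<open>T n = (\<Sum>k\<le>n. X\<^sup>k Y\<^sup>n\<^sup>-\<^sup>k / (k! (n-k)!))\<close> be the degree \<open>n\<close> part of \<open>e\<^sup>X e\<^sup>Y\<close>,
  \<open>E n = [T n, Y]\<close>, and let \<open>D n\<close> be the difference of \<open>T n\<close> and the degree \<open>n\<close> part
  of \<open>e\<^sup>X\<^sup>+\<^sup>Y\<close>. From \<open>(n+1) T (n+1) = X T n + T n Y\<close> one gets
  \<open>(n+1) E (n+1) = X E n + E n Y + [X,Y] T n\<close> and
  \<open>(n+1) D (n+1) = (X+Y) D n + E n\<close>. With \<open>s = \<parallel>X\<parallel> + \<parallel>Y\<parallel>\<close> and \<open>c = \<parallel>[X,Y]\<parallel>\<close> these recurrences give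
  \<open>\<parallel>T n\<parallel> \<le> s\<^sup>n / n!\<close>, \<open>\<parallel>E (n+1)\<parallel> \<le> c s\<^sup>n / n!\<close> and
  \<open>\<parallel>D (n+2)\<parallel> \<le> c s\<^sup>n / (2 n!)\<close>, while \<open>D 0 = D 1 = 0\<close>. Summing over \<open>n\<close> yields the bound
  \<open>e\<^sup>s c / 2\<close>, and \<open>1/2 = g 0 \<le> g \<parallel>X\<parallel>\<close>.
\<close>

text \<open>On \<open>{0..1}\<close> the weight \<open>1 - s\<close> is nonnegative and
  \<open>exp (2 * z * s) \<ge> 1\<close>, so the integrand for \<open>z\<close> dominates pointwise
  the one for \<open>0\<close>.\<close>

lemma g_ge_half:
  assumes "0 \<le> z"
  shows "1 / 2 \<le> g z"
proof -
  have "g 0 \<le> g z"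
    by (rule has_integral_le[OF g_has_integral g_has_integral])
       (use assms mult_left_mono[of 1 "exp (2 * z * x)" "1 - x" for x] in auto)
  then show ?thesis by (simp add: g_zero)
qed

section \<open>Algebra of the matrix product\<close>

lemma scaleR_matrix_mult_left: "(c *\<^sub>R A) ** (B :: real^'n^'m) = c *\<^sub>R (A ** B)"
  by (simp add: matrix_matrix_mult_def vec_eq_iff sum_distrib_left mult.assoc)

lemma matrix_mult_scaleR_right: "A ** (c *\<^sub>R B :: real^'n^'m) = c *\<^sub>R (A ** B)"
  by (simp add: matrix_matrix_mult_def vec_eq_iff sum_distrib_left mult.left_commute)

lemma matrix_mult_add_left: "(A + B) ** C = A ** C + B ** (C :: real^'n^'m)"
  by (simp add: matrix_matrix_mult_def vec_eq_iff sum.distrib algebra_simps)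

lemma matrix_mult_add_right: "A ** (B + C) = A ** B + A ** (C :: real^'n^'m)"
  by (simp add: matrix_matrix_mult_def vec_eq_iff sum.distrib algebra_simps)

lemma matrix_mult_diff_left: "(A - B) ** C = A ** C - B ** (C :: real^'n^'m)"
  by (simp add: matrix_matrix_mult_def vec_eq_iff sum_subtractf algebra_simps)

lemma matrix_mult_diff_right: "A ** (B - C) = A ** B - A ** (C :: real^'n^'m)"
  by (simp add: matrix_matrix_mult_def vec_eq_iff sum_subtractf algebra_simps)

lemmas matrix_mult_distribs = scaleR_matrix_mult_left matrix_mult_scaleR_right
  matrix_mult_add_left matrix_mult_add_right matrix_mult_diff_left matrix_mult_diff_right

lemma sum_matrix_mult_left: "sum f S ** B = (\<Sum>k\<in>S. f k ** (B :: real^'n^'m))"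
  by (induction S rule: infinite_finite_induct) (simp_all add: matrix_mult_add_left)

lemma matrix_mult_sum_right: "A ** sum f S = (\<Sum>k\<in>S. A ** (f k :: real^'n^'m))"
  by (induction S rule: infinite_finite_induct) (simp_all add: matrix_mult_add_right)

section \<open>Homogeneous parts of the exponential and of the product\<close>

definition exp_term :: "real^'n^'n \<Rightarrow> nat \<Rightarrow> real^'n^'n" where
  "exp_term A k = (1 / fact k) *\<^sub>R matrix_pow A k"

lemma exp_term_0: "exp_term A 0 = mat 1"
  by (simp add: exp_term_def matrix_pow_def)

lemma exp_term_Suc: "real (Suc k) *\<^sub>R exp_term A (Suc k) = A ** exp_term A k"
  by (simp add: exp_term_def matrix_pow_def matrix_mult_distribs del: of_nat_Suc)

lemma matrix_pow_comm: "matrix_pow A k ** A = A ** matrix_pow A k"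
  by (induction k) (simp_all add: matrix_pow_def flip: matrix_mul_assoc)

lemma exp_term_Suc': "real (Suc k) *\<^sub>R exp_term A (Suc k) = exp_term A k ** A"
  unfolding exp_term_Suc by (simp add: exp_term_def matrix_mult_distribs matrix_pow_comm)

lemma exp_term_sums: "exp_term A sums matrix_exp A"
  unfolding exp_term_def[abs_def] matrix_exp_def by (rule summable_sums[OF summable_matrix_exp])

text \<open>Absolute convergence of each entry is what the Cauchy product of real series
  requires.\<close>

lemma summable_norm_exp_term: "summable (\<lambda>k. norm (exp_term A k $ i $ j))"
proof -
  let ?c = "real CARD('a) * norm A"
  have entry: "\<bar>A $ i $ j\<bar> \<le> norm A" for i j
    by (metis Finite_Cartesian_Product.norm_nth_le order_trans real_norm_def)
  have le: "norm (norm (exp_term A k $ i $ j)) \<le> ?c ^ k / fact k" for k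
    using divide_right_mono[OF matrix_pow_entry_bound[OF entry, of k i j], of "fact k"]
    by (simp add: exp_term_def abs_mult)
  have "summable (\<lambda>k. ?c ^ k / fact k)"
    using summable_exp_generic[of ?c] by (simp add: divide_inverse mult.commute)
  then show ?thesis
    using le by (rule summable_comparison_test')
qed

text \<open>This is \<open>T n\<close> of the overview; \<open>exp_defect X Y n\<close> below is
  \<open>D n\<close>.\<close>

definition cauchy_term :: "real^'n^'n \<Rightarrow> real^'n^'n \<Rightarrow> nat \<Rightarrow> real^'n^'n" where
  "cauchy_term X Y n = (\<Sum>k\<le>n. exp_term X k ** exp_term Y (n - k))"

text \<open>Each entry of the product is a finite sum over \<open>l\<close> of products of two real
  series, so the scalar Cauchy product applies entry by entry.\<close>

lemma cauchy_term_sums: "cauchy_term X Y sums (matrix_exp X ** matrix_exp Y)"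
proof -
  have entry: "(\<lambda>n. exp_term A n $ i $ j) sums (matrix_exp A $ i $ j)" for A :: "real^'n^'n" and i j
    using tendsto_vec_nth[OF tendsto_vec_nth[OF exp_term_sums[of A, unfolded sums_def]], of i j]
    by (simp add: sums_def sum_component)
  have prod: "(\<lambda>n. \<Sum>k\<le>n. exp_term X k $ i $ l * exp_term Y (n - k) $ l $ j)
      sums (matrix_exp X $ i $ l * matrix_exp Y $ l $ j)" for i l j
    using Cauchy_product_sums[OF summable_norm_exp_term summable_norm_exp_term, of X i l Y l j]
    by (simp add: sums_unique[OF entry, symmetric])
  have "(\<lambda>n. cauchy_term X Y n $ i $ j) sums ((matrix_exp X ** matrix_exp Y) $ i $ j)" for i j
    using sums_sum[where I = UNIV, OF prod[of i _ j]]
    by (simp add: cauchy_term_def matrix_matrix_mult_def sum_component sum.swap[of _ UNIV])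
  then show ?thesis
    unfolding sums_def by (auto intro!: vec_tendstoI simp: sum_component)
qed

lemma cauchy_term_0: "cauchy_term X Y 0 = mat 1"
  by (simp add: cauchy_term_def exp_term_0)

text \<open>Split the degree as \<open>k + (Suc n - k)\<close>. The weight \<open>k\<close> cancels
  against the factorial of the left factor and releases an \<open>X\<close> on the far left; the
  weight \<open>Suc n - k\<close> releases a \<open>Y\<close> on the far right.\<close>

lemma cauchy_term_Suc:
  "real (Suc n) *\<^sub>R cauchy_term X Y (Suc n) = X ** cauchy_term X Y n + cauchy_term X Y n ** Y"
proof -
  let ?p = "\<lambda>k. exp_term X k ** exp_term Y (Suc n - k)"
  have "real (Suc n) *\<^sub>R cauchy_term X Y (Suc n)
      = (\<Sum>k\<le>Suc n. real k *\<^sub>R ?p k + real (Suc n - k) *\<^sub>R ?p k)"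
    unfolding cauchy_term_def scaleR_sum_right
    by (intro sum.cong refl) (simp add: of_nat_diff flip: scaleR_left_distrib)
  also have "\<dots> = (\<Sum>k\<le>Suc n. real k *\<^sub>R ?p k) + (\<Sum>k\<le>Suc n. real (Suc n - k) *\<^sub>R ?p k)"
    by (rule sum.distrib)
  \<comment> \<open>The summand \<open>k = 0\<close> has weight zero, so the index can be
    shifted.\<close>
  also have "(\<Sum>k\<le>Suc n. real k *\<^sub>R ?p k)
      = (\<Sum>k\<le>n. (real (Suc k) *\<^sub>R exp_term X (Suc k)) ** exp_term Y (n - k))"
    by (simp add: sum.atMost_Suc_shift scaleR_matrix_mult_left del: of_nat_Suc sum.atMost_Suc)
  also have "\<dots> = X ** cauchy_term X Y n"
    unfolding exp_term_Suc by (simp add: cauchy_term_def matrix_mult_sum_right matrix_mul_assoc)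
  also have "(\<Sum>k\<le>Suc n. real (Suc n - k) *\<^sub>R ?p k)
      = (\<Sum>k\<le>n. exp_term X k ** (real (Suc (n - k)) *\<^sub>R exp_term Y (Suc (n - k))))"
    by (auto simp: matrix_mult_scaleR_right Suc_diff_le intro!: sum.cong)
  also have "\<dots> = cauchy_term X Y n ** Y"
    unfolding exp_term_Suc' by (simp add: cauchy_term_def sum_matrix_mult_left matrix_mul_assoc)
  finally show ?thesis .
qed

text \<open>Apply the derivation \<open>[_, Y]\<close> to the recurrence for \<open>T\<close>: the
  Leibniz rule splits \<open>[X T, Y]\<close> into \<open>X [T, Y] + [X, Y] T\<close>, and
  \<open>[T Y, Y] = [T, Y] Y\<close>.\<close>

lemma commutator_cauchy_term_Suc:
  "real (Suc n) *\<^sub>R commutator (cauchy_term X Y (Suc n)) Y =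
    X ** commutator (cauchy_term X Y n) Y + commutator (cauchy_term X Y n) Y ** Y
      + commutator X Y ** cauchy_term X Y n"
proof -
  have "real (Suc n) *\<^sub>R commutator (cauchy_term X Y (Suc n)) Y
      = commutator (real (Suc n) *\<^sub>R cauchy_term X Y (Suc n)) Y"
    by (simp add: commutator_def matrix_mult_distribs scaleR_diff_right del: of_nat_Suc)
  then show ?thesis
    unfolding cauchy_term_Suc by (simp add: commutator_def matrix_mult_distribs matrix_mul_assoc)
qed

definition exp_defect :: "real^'n^'n \<Rightarrow> real^'n^'n \<Rightarrow> nat \<Rightarrow> real^'n^'n" where
  "exp_defect X Y n = cauchy_term X Y n - exp_term (X + Y) n"

lemma exp_defect_sums:
  "exp_defect X Y sums (matrix_exp X ** matrix_exp Y - matrix_exp (X + Y))"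
  unfolding exp_defect_def[abs_def] by (intro sums_diff cauchy_term_sums exp_term_sums)

text \<open>Rewrite \<open>X T + T Y\<close> as \<open>(X + Y) T + [T, Y]\<close> and subtract the
  recurrence for the exponential of \<open>X + Y\<close>.\<close>

lemma exp_defect_Suc:
  "real (Suc n) *\<^sub>R exp_defect X Y (Suc n) =
    (X + Y) ** exp_defect X Y n + commutator (cauchy_term X Y n) Y"
  unfolding exp_defect_def scaleR_diff_right exp_term_Suc cauchy_term_Suc
  by (simp add: commutator_def matrix_mult_distribs)

lemma commutator_cauchy_term_0: "commutator (cauchy_term X Y 0) Y = 0"
  by (simp add: cauchy_term_0 commutator_def)

lemma exp_defect_0: "exp_defect X Y 0 = 0"
  by (simp add: exp_defect_def cauchy_term_0 exp_term_0)

lemma exp_defect_1: "exp_defect X Y (Suc 0) = 0"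
  using exp_defect_Suc[of 0 X Y] by (simp add: exp_defect_0 commutator_cauchy_term_0)

section \<open>The norm induced by \<open>Q\<close> and its operator norm\<close>

context
  fixes Q :: "real^'n^'n"
  assumes sym: "transpose Q = Q" and pd: "pos_def_matrix Q"
begin

lemma vec_norm_Q_nonneg: "0 \<le> vec_norm_Q Q x"
  using vec_norm_Q_pos[OF pd, of x] by (cases "x = 0") (auto simp: vec_norm_Q_def)

lemma vec_norm_Q_square: "(vec_norm_Q Q x)\<^sup>2 = x \<bullet> (Q *v x)"
  using vec_norm_Q_nonneg[of x] by (simp add: vec_norm_Q_def)

lemma inner_Q_commute: "x \<bullet> (Q *v y) = y \<bullet> (Q *v x)"
  by (metis dot_lmul_matrix inner_commute sym transpose_matrix_vector)

text \<open>Cauchy-Schwarz for the inner product of \<open>Q\<close>: with \<open>a\<close>,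
  \<open>b\<close> the norms of \<open>x\<close>, \<open>y\<close>, expand the square of the norm of
  \<open>b x - a y\<close> and divide by \<open>a b\<close>.\<close>

lemma inner_Q_le: "x \<bullet> (Q *v y) \<le> vec_norm_Q Q x * vec_norm_Q Q y"
proof (cases "x = 0 \<or> y = 0")
  case True
  then show ?thesis by (auto simp: vec_norm_Q_def)
next
  case False
  define a where "a = vec_norm_Q Q x"
  define b where "b = vec_norm_Q Q y"
  have pos: "0 < a * b"
    using False vec_norm_Q_pos[OF pd] by (simp add: a_def b_def)
  have "0 \<le> (vec_norm_Q Q (b *\<^sub>R x - a *\<^sub>R y))\<^sup>2"
    by simp
  also have "\<dots> = b\<^sup>2 * (x \<bullet> (Q *v x)) - 2 * (a * b) * (x \<bullet> (Q *v y)) + a\<^sup>2 * (y \<bullet> (Q *v y))"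
    unfolding vec_norm_Q_square using inner_Q_commute[of y x]
    by (simp add: power2_eq_square algebra_simps inner_diff matrix_vector_mult_diff_distrib
        matrix_vector_mult_scaleR)
  also have "\<dots> = b\<^sup>2 * a\<^sup>2 - 2 * (a * b) * (x \<bullet> (Q *v y)) + a\<^sup>2 * b\<^sup>2"
    by (simp add: a_def b_def vec_norm_Q_square)
  finally have "(a * b) * (x \<bullet> (Q *v y)) \<le> (a * b) * (a * b)"
    by (simp add: power2_eq_square mult_ac)
  then show ?thesis
    using pos by (simp only: mult_le_cancel_left_pos flip: a_def b_def)
qed

lemma vec_norm_Q_triangle: "vec_norm_Q Q (x + y) \<le> vec_norm_Q Q x + vec_norm_Q Q y"
proof (rule power2_le_imp_le)
  show "(vec_norm_Q Q (x + y))\<^sup>2 \<le> (vec_norm_Q Q x + vec_norm_Q Q y)\<^sup>2"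
    using inner_Q_le[of x y] inner_Q_commute[of y x]
    by (simp add: power2_sum vec_norm_Q_square inner_add matrix_vector_right_distrib)
qed (simp add: vec_norm_Q_nonneg)

lemma continuous_vec_norm_Q: "continuous_on UNIV (vec_norm_Q Q)"
proof -
  have "continuous_on UNIV ((*v) Q)" by (rule linear_continuous_on) simp
  then show ?thesis unfolding vec_norm_Q_def[abs_def] by (intro continuous_intros)
qed

lemma op_norm_Q_leI:
  assumes "\<And>x. vec_norm_Q Q (M *v x) \<le> B * vec_norm_Q Q x"
  shows "op_norm_Q Q M \<le> B"
  unfolding op_norm_Q_def
proof (rule cSUP_least)
  show "{x :: real^'n. x \<noteq> 0} \<noteq> {}"
    by (auto intro: exI[of _ "axis undefined 1"])
  fix x :: "real^'n"
  assume "x \<in> {x. x \<noteq> 0}"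
  then show "vec_norm_Q Q (M *v x) / vec_norm_Q Q x \<le> B"
    using vec_norm_Q_pos[OF pd, of x] assms[of x] by (simp add: divide_le_eq)
qed

lemma vec_norm_Q_mult_le: "vec_norm_Q Q (M *v x) \<le> op_norm_Q Q M * vec_norm_Q Q x"
proof (cases "x = 0")
  case True
  then show ?thesis by (simp add: vec_norm_Q_def)
next
  case False
  then have "vec_norm_Q Q (M *v x) / vec_norm_Q Q x \<le> op_norm_Q Q M"
    unfolding op_norm_Q_def by (intro cSUP_upper bdd_above_op_norm_Q pd) simp
  then show ?thesis
    using vec_norm_Q_pos[OF pd False] by (simp add: divide_le_eq)
qed

lemma op_norm_Q_nonneg: "0 \<le> op_norm_Q Q M"
proof -
  obtain x :: "real^'n" where "x \<noteq> 0"
    using zero_neq_one by blast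
  then have "0 < vec_norm_Q Q x" by (rule vec_norm_Q_pos[OF pd])
  moreover have "0 \<le> op_norm_Q Q M * vec_norm_Q Q x"
    using vec_norm_Q_nonneg vec_norm_Q_mult_le by (rule order_trans)
  ultimately show ?thesis by (simp add: zero_le_mult_iff)
qed

lemma op_norm_Q_mult: "op_norm_Q Q (A ** B) \<le> op_norm_Q Q A * op_norm_Q Q B"
proof (rule op_norm_Q_leI)
  fix x
  have "vec_norm_Q Q (A *v (B *v x)) \<le> op_norm_Q Q A * vec_norm_Q Q (B *v x)"
    by (rule vec_norm_Q_mult_le)
  also have "\<dots> \<le> op_norm_Q Q A * (op_norm_Q Q B * vec_norm_Q Q x)"
    by (intro mult_left_mono vec_norm_Q_mult_le op_norm_Q_nonneg)
  finally show "vec_norm_Q Q (A ** B *v x) \<le> op_norm_Q Q A * op_norm_Q Q B * vec_norm_Q Q x"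
    by (simp add: matrix_vector_mul_assoc mult.assoc)
qed

lemma op_norm_Q_triangle: "op_norm_Q Q (A + B) \<le> op_norm_Q Q A + op_norm_Q Q B"
proof (rule op_norm_Q_leI)
  fix x
  show "vec_norm_Q Q ((A + B) *v x) \<le> (op_norm_Q Q A + op_norm_Q Q B) * vec_norm_Q Q x"
    using vec_norm_Q_triangle[of "A *v x" "B *v x"] vec_norm_Q_mult_le[of A x] vec_norm_Q_mult_le[of B x]
    by (simp add: matrix_vector_mult_add_rdistrib distrib_right)
qed

lemma op_norm_Q_zero: "op_norm_Q Q 0 = 0"
proof (rule antisym)
  show "op_norm_Q Q 0 \<le> 0"
    by (rule op_norm_Q_leI) (simp add: vec_norm_Q_def)
qed (rule op_norm_Q_nonneg)

lemma op_norm_Q_mat_1: "op_norm_Q Q (mat 1) \<le> 1"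
  by (rule op_norm_Q_leI) simp

lemma op_norm_Q_sum: "op_norm_Q Q (sum f S) \<le> (\<Sum>k\<in>S. op_norm_Q Q (f k))"
proof (induction S rule: infinite_finite_induct)
  case (insert k S)
  then show ?case using op_norm_Q_triangle[of "f k" "sum f S"] by simp
qed (simp_all add: op_norm_Q_zero)

text \<open>The recurrences bound \<open>Suc n\<close> times a term; this removes that
  factor.\<close>

lemma op_norm_Q_scaled_leD:
  assumes "0 < c" and "op_norm_Q Q (c *\<^sub>R A) \<le> c * B"
  shows "op_norm_Q Q A \<le> B"
proof (rule op_norm_Q_leI)
  fix x
  have "c * vec_norm_Q Q (A *v x) = vec_norm_Q Q ((c *\<^sub>R A) *v x)"
    using assms(1) by (simp add: vec_norm_Q_scaleR scaleR_matrix_vector_assoc[symmetric])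
  also have "\<dots> \<le> op_norm_Q Q (c *\<^sub>R A) * vec_norm_Q Q x"
    by (rule vec_norm_Q_mult_le)
  also have "\<dots> \<le> (c * B) * vec_norm_Q Q x"
    by (intro mult_right_mono assms vec_norm_Q_nonneg)
  finally show "vec_norm_Q Q (A *v x) \<le> B * vec_norm_Q Q x"
    using assms(1) by (simp add: mult.assoc)
qed

lemma op_norm_Q_mult_mono:
  assumes "op_norm_Q Q A \<le> a" and "op_norm_Q Q B \<le> b"
  shows "op_norm_Q Q (A ** B) \<le> a * b"
  by (intro order_trans[OF op_norm_Q_mult] mult_mono assms op_norm_Q_nonneg
      order_trans[OF op_norm_Q_nonneg assms(1)])

lemma op_norm_Q_add_mono:
  assumes "op_norm_Q Q A \<le> a" and "op_norm_Q Q B \<le> b"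
  shows "op_norm_Q Q (A + B) \<le> a + b"
  using op_norm_Q_triangle[of A B] assms by linarith

text \<open>The limit is taken after applying the partial sums to a fixed vector, so continuity of
  the vector norm suffices.\<close>

lemma op_norm_Q_sums_le:
  assumes "f sums M" and "\<And>m. (\<Sum>n<m. op_norm_Q Q (f n)) \<le> B"
  shows "op_norm_Q Q M \<le> B"
proof (rule op_norm_Q_leI)
  fix x
  have "linear (\<lambda>A :: real^'n^'n. A *v x)"
    by (intro linearI) (simp_all add: matrix_vector_mult_add_rdistrib scaleR_matrix_vector_assoc)
  then have "bounded_linear (\<lambda>A :: real^'n^'n. A *v x)"
    by (rule linear_conv_bounded_linear[THEN iffD1])
  then have "(\<lambda>m. sum f {..<m} *v x) \<longlonglongrightarrow> M *v x"
    using assms(1) unfolding sums_def by (rule bounded_linear.tendsto)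
  then have "(\<lambda>m. vec_norm_Q Q (sum f {..<m} *v x)) \<longlonglongrightarrow> vec_norm_Q Q (M *v x)"
    using continuous_on_tendsto_compose[OF continuous_vec_norm_Q] by fastforce
  moreover have "vec_norm_Q Q (sum f {..<m} *v x) \<le> B * vec_norm_Q Q x" for m
    using op_norm_Q_sum[of f "{..<m}"] assms(2)[of m]
    by (intro order_trans[OF vec_norm_Q_mult_le] mult_right_mono vec_norm_Q_nonneg) linarith
  ultimately show "vec_norm_Q Q (M *v x) \<le> B * vec_norm_Q Q x"
    by (blast intro: LIMSEQ_le_const2)
qed

section \<open>Norm bounds for the homogeneous parts\<close>

context
  fixes X Y :: "real^'n^'n" and s c :: real
  defines "s \<equiv> op_norm_Q Q X + op_norm_Q Q Y" and "c \<equiv> op_norm_Q Q (commutator X Y)"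
begin

lemma op_norm_Q_cauchy_term: "op_norm_Q Q (cauchy_term X Y n) \<le> s ^ n / fact n"
proof (induction n)
  case 0
  then show ?case by (simp add: cauchy_term_0 op_norm_Q_mat_1)
next
  case (Suc n)
  have "op_norm_Q Q (X ** cauchy_term X Y n + cauchy_term X Y n ** Y)
      \<le> op_norm_Q Q X * (s ^ n / fact n) + (s ^ n / fact n) * op_norm_Q Q Y"
    by (intro op_norm_Q_add_mono op_norm_Q_mult_mono Suc order_refl)
  also have "\<dots> = real (Suc n) * (s ^ Suc n / fact (Suc n))"
    by (simp add: s_def algebra_simps add_divide_distrib del: of_nat_Suc)
  finally show ?case
    unfolding cauchy_term_Suc[symmetric] by (rule op_norm_Q_scaled_leD[rotated]) simp
qed

lemma op_norm_Q_commutator_cauchy_term: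
  "op_norm_Q Q (commutator (cauchy_term X Y (Suc n)) Y) \<le> c * s ^ n / fact n"
proof (induction n)
  case 0
  have "commutator (cauchy_term X Y (Suc 0)) Y = commutator X Y"
    using commutator_cauchy_term_Suc[of 0 X Y]
    unfolding commutator_cauchy_term_0 by (simp add: cauchy_term_0)
  then show ?case by (simp add: c_def)
next
  case (Suc n)
  let ?E = "commutator (cauchy_term X Y (Suc n)) Y"
  have "op_norm_Q Q (X ** ?E + ?E ** Y + commutator X Y ** cauchy_term X Y (Suc n))
      \<le> op_norm_Q Q X * (c * s ^ n / fact n) + (c * s ^ n / fact n) * op_norm_Q Q Y
        + c * (s ^ Suc n / fact (Suc n))"
    unfolding c_def
    by (intro op_norm_Q_add_mono op_norm_Q_mult_mono Suc[unfolded c_def] op_norm_Q_cauchy_term order_refl)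
  also have "\<dots> = c * s ^ Suc n / fact n + c * s ^ Suc n / fact (Suc n)"
    by (simp add: s_def algebra_simps add_divide_distrib del: of_nat_Suc fact_Suc)
  \<comment> \<open>The terms with \<open>?E\<close> contribute \<open>n + 1\<close> copies of the
    target bound and \<open>[X, Y] T\<close> one more, matching the factor \<open>n + 2\<close> of
    the recurrence.\<close>
  also have "c * s ^ Suc n / fact n = real (Suc n) * (c * s ^ Suc n / fact (Suc n))"
    by (simp del: power_Suc of_nat_Suc)
  also have "\<dots> + c * s ^ Suc n / fact (Suc n) = real (Suc (Suc n)) * (c * s ^ Suc n / fact (Suc n))"
    by (simp add: algebra_simps add_divide_distrib del: power_Suc fact_Suc)
  finally show ?case
    unfolding commutator_cauchy_term_Suc[symmetric] by (rule op_norm_Q_scaled_leD[rotated]) simp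
qed

text \<open>The factor \<open>1/2\<close> arises in degree two, where \<open>2 D 2 = E 1\<close>
  because \<open>D 1 = 0\<close>. It persists: \<open>(X + Y) D\<close> contributes
  \<open>n + 1\<close> copies of the next bound and the commutator term two, together
  \<open>n + 3\<close>.\<close>

lemma op_norm_Q_exp_defect:
  "op_norm_Q Q (exp_defect X Y (Suc (Suc n))) \<le> c / 2 * (s ^ n / fact n)"
proof (induction n)
  case 0
  have "op_norm_Q Q (real (Suc (Suc 0)) *\<^sub>R exp_defect X Y (Suc (Suc 0)))
      \<le> real (Suc (Suc 0)) * (c / 2 * (s ^ 0 / fact 0))"
    unfolding exp_defect_Suc[of "Suc 0"]
    using op_norm_Q_commutator_cauchy_term[of 0] by (simp add: exp_defect_1)
  then show ?case by (rule op_norm_Q_scaled_leD[rotated]) simp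
next
  case (Suc n)
  have "op_norm_Q Q (real (Suc (Suc (Suc n))) *\<^sub>R exp_defect X Y (Suc (Suc (Suc n))))
      \<le> s * (c / 2 * (s ^ n / fact n)) + c * s ^ Suc n / fact (Suc n)"
    unfolding exp_defect_Suc[of "Suc (Suc n)"] s_def
    by (intro op_norm_Q_add_mono op_norm_Q_mult_mono op_norm_Q_triangle Suc[unfolded s_def]
        op_norm_Q_commutator_cauchy_term[unfolded s_def])
  also have "s * (c / 2 * (s ^ n / fact n)) = real (Suc n) * (c / 2 * (s ^ Suc n / fact (Suc n)))"
    by (simp del: of_nat_Suc)
  also have "\<dots> + c * s ^ Suc n / fact (Suc n)
      = real (Suc (Suc (Suc n))) * (c / 2 * (s ^ Suc n / fact (Suc n)))"
    by (simp add: algebra_simps add_divide_distrib del: power_Suc fact_Suc)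
  finally show ?case by (rule op_norm_Q_scaled_leD[rotated]) simp
qed

lemma op_norm_Q_exp_mult_diff:
  "op_norm_Q Q (matrix_exp X ** matrix_exp Y - matrix_exp (X + Y)) \<le> c / 2 * exp s"
proof (rule op_norm_Q_sums_le[OF exp_defect_sums])
  fix m
  let ?N = "\<lambda>n. op_norm_Q Q (exp_defect X Y n)"
  have nonneg: "0 \<le> s" "0 \<le> c" by (simp_all add: s_def c_def op_norm_Q_nonneg)
  have exp: "(\<lambda>n. s ^ n / fact n) sums exp s"
    using exp_converges[of s] by (simp add: divide_inverse mult.commute)
  \<comment> \<open>Two more terms are added because the first two vanish; the shifted sum then has
    exactly \<open>m\<close> terms.\<close>
  have "sum ?N {..<m} \<le> sum ?N {..<Suc (Suc m)}"
    by (simp add: op_norm_Q_nonneg)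
  also have "\<dots> = (\<Sum>n<m. ?N (Suc (Suc n)))"
    unfolding sum.lessThan_Suc_shift by (simp add: exp_defect_0 exp_defect_1 op_norm_Q_zero)
  also have "\<dots> \<le> (\<Sum>n<m. c / 2 * (s ^ n / fact n))"
    by (intro sum_mono op_norm_Q_exp_defect)
  also have "\<dots> = c / 2 * (\<Sum>n<m. s ^ n / fact n)"
    by (rule sum_distrib_left[symmetric])
  also have "\<dots> \<le> c / 2 * exp s"
    unfolding sums_unique[OF exp]
    using nonneg by (intro mult_left_mono sum_le_suminf sums_summable[OF exp]) auto
  finally show "sum ?N {..<m} \<le> c / 2 * exp s" .
qed

end

end

theorem lemma5:
  fixes Q X Y :: "real^'n^'n"
  assumes "transpose Q = Q" and "pos_def_matrix Q"
  shows "op_norm_Q Q (matrix_exp X ** matrix_exp Y - matrix_exp (X + Y))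
    \<le> exp (op_norm_Q Q X + op_norm_Q Q Y) * g (op_norm_Q Q X) * op_norm_Q Q (commutator X Y)"
proof -
  let ?e = "exp (op_norm_Q Q X + op_norm_Q Q Y)" and ?c = "op_norm_Q Q (commutator X Y)"
  have "op_norm_Q Q (matrix_exp X ** matrix_exp Y - matrix_exp (X + Y)) \<le> ?c / 2 * ?e"
    by (rule op_norm_Q_exp_mult_diff[OF assms])
  also have "\<dots> = ?e * (1 / 2) * ?c" by simp
  \<comment> \<open>The only place where \<open>g\<close> enters: its argument is a norm, hence
    nonnegative, so \<open>g\<close> is at least \<open>1/2\<close> there.\<close>
  also have "\<dots> \<le> ?e * g (op_norm_Q Q X) * ?c"
    by (intro mult_right_mono mult_left_mono g_ge_half op_norm_Q_nonneg[OF assms]) simp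
  finally show ?thesis .
qed

end
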